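(* Let $(X,\mu)$ be an irreducible discrete-time BRW with independent diffusion, with diffusion matrix $P$ the transition matrix of a recurrent random walk on $X$ and $\rho_x=\rho$ for all $x\in X$. If there is global survival starting from some $x\in X$, then $q(w,y)=\bar q(w)<1$ for all $w,y\in X$ (strong local survival at every $y$ starting from every $w$).
   Context: $S_X:=\{f:X\to\mathbb N:\sum_yf(y)<\infty\}$, $X$ countable. A BRW with independent diffusion is given by offspring laws $\rho_x$ on $\mathbb N$ and a stochastic matrix $P=(p(x,y))$: $\mu_x(f)=\rho_x(\sum_yf(y))\frac{(\sum_yf(y))!}{\prod_yf(y)!}\prod_yp(x,y)^{f(y)}$, i.e. each particle at $x$ is replaced by a random number of children with law $\rho_x$, placed independently according to $p(x,\cdot)$. First moments $m_{xy}=p(x,y)\bar\rho_x$, $\bar\rho_x$ the mean of $\rho_x$; irreducible means every $y$ is reachable from every $x$ via a path with $m_{x_ix_{i+1}}>0$. Standing assumption: in every class of mutually reachable vertices there is a vertex at which a particle has, with positive probability, a number of children inside the class different from one. Global survival from $x$: with positive probability particles exist at every generation starting from one particle at $x$; $\bar q(x)$ is the probability of eventual total extinction and $q(w,y)$ the probability, starting from one particle at $w$, that eventually no particle is at $y$. *)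

theory Defs
  imports "HOL-Probability.Probability"
begin

text \<open>Branching random walk with independent diffusion on a countable set 'x.
  Particles are labelled by Ulam-Harris labels, encoded as reversed lists:
  i # u is the i-th child of u, and [] is the ancestor.
  The randomness is an independent family indexed by (label, site): the coordinate
  (u, x) is a pair (N, Y) with N ~ rho x and Y ~ p x independent.  A particle u sitting
  at site x has fst (omega (u, x)) children; the child i # u of a particle at x is placed
  at snd (omega (i # u, x)).\<close>

type_synonym 'x brw_omega = "nat list \<times> 'x \<Rightarrow> nat \<times> 'x"

definition brw_space :: "('x \<Rightarrow> nat pmf) \<Rightarrow> ('x \<Rightarrow> 'x pmf) \<Rightarrow> 'x brw_omega measure" where
  "brw_space rho p = PiM UNIV (\<lambda>(u, x). measure_pmf (pair_pmf (rho x) (p x)))"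

fun brw_pos :: "'x \<Rightarrow> 'x brw_omega \<Rightarrow> nat list \<Rightarrow> 'x" where
  "brw_pos w \<omega> [] = w"
| "brw_pos w \<omega> (i # u) = snd (\<omega> (i # u, brw_pos w \<omega> u))"

fun brw_alive :: "'x \<Rightarrow> 'x brw_omega \<Rightarrow> nat list \<Rightarrow> bool" where
  "brw_alive w \<omega> [] = True"
| "brw_alive w \<omega> (i # u) = (brw_alive w \<omega> u \<and> i < fst (\<omega> (u, brw_pos w \<omega> u)))"

text \<open>Global survival starting from one particle at w.\<close>
definition global_survival :: "('x \<Rightarrow> nat pmf) \<Rightarrow> ('x \<Rightarrow> 'x pmf) \<Rightarrow> 'x \<Rightarrow> bool" where
  "global_survival rho p w \<longleftrightarrow>
     measure (brw_space rho p) {\<omega>. \<forall>n. \<exists>u. length u = n \<and> brw_alive w \<omega> u} > 0"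

text \<open>bar q(w): probability of eventual total extinction.\<close>
definition ext_prob :: "('x \<Rightarrow> nat pmf) \<Rightarrow> ('x \<Rightarrow> 'x pmf) \<Rightarrow> 'x \<Rightarrow> real" where
  "ext_prob rho p w =
     measure (brw_space rho p) {\<omega>. \<exists>n. \<forall>u. length u = n \<longrightarrow> \<not> brw_alive w \<omega> u}"

text \<open>q(w,y): probability that eventually no particle is at y.\<close>
definition local_ext_prob :: "('x \<Rightarrow> nat pmf) \<Rightarrow> ('x \<Rightarrow> 'x pmf) \<Rightarrow> 'x \<Rightarrow> 'x \<Rightarrow> real" where
  "local_ext_prob rho p w y =
     measure (brw_space rho p)
       {\<omega>. \<exists>n0. \<forall>u. brw_alive w \<omega> u \<and> length u \<ge> n0 \<longrightarrow> brw_pos w \<omega> u \<noteq> y}"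

text \<open>Mean of rho x (possibly infinite) and first moments m_xy = p(x,y) * bar rho_x.\<close>
definition rho_bar :: "('x \<Rightarrow> nat pmf) \<Rightarrow> 'x \<Rightarrow> ennreal" where
  "rho_bar rho x = (\<integral>\<^sup>+ n. ennreal (real n) \<partial>measure_pmf (rho x))"

definition first_moment :: "('x \<Rightarrow> nat pmf) \<Rightarrow> ('x \<Rightarrow> 'x pmf) \<Rightarrow> 'x \<Rightarrow> 'x \<Rightarrow> ennreal" where
  "first_moment rho p x y = ennreal (pmf (p x) y) * rho_bar rho x"

definition brw_edges :: "('x \<Rightarrow> nat pmf) \<Rightarrow> ('x \<Rightarrow> 'x pmf) \<Rightarrow> ('x \<times> 'x) set" where
  "brw_edges rho p = {(x, y). first_moment rho p x y > 0}"

definition brw_irreducible :: "('x \<Rightarrow> nat pmf) \<Rightarrow> ('x \<Rightarrow> 'x pmf) \<Rightarrow> bool" where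
  "brw_irreducible rho p \<longleftrightarrow> (\<forall>x y. (x, y) \<in> (brw_edges rho p)\<^sup>*)"

text \<open>Class of mutually reachable vertices containing x.\<close>
definition brw_class :: "('x \<Rightarrow> nat pmf) \<Rightarrow> ('x \<Rightarrow> 'x pmf) \<Rightarrow> 'x \<Rightarrow> 'x set" where
  "brw_class rho p x = {y. (x, y) \<in> (brw_edges rho p)\<^sup>* \<and> (y, x) \<in> (brw_edges rho p)\<^sup>*}"

text \<open>Standing assumption: in every class C there is a vertex x at which a particle has,
  with positive probability, a number of children inside C different from one.\<close>
definition standing_assumption :: "('x \<Rightarrow> nat pmf) \<Rightarrow> ('x \<Rightarrow> 'x pmf) \<Rightarrow> bool" where
  "standing_assumption rho p \<longleftrightarrow>
     (\<forall>z. \<exists>x \<in> brw_class rho p z.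
        measure (brw_space rho p)
          {\<omega>. card {i. i < fst (\<omega> ([], x)) \<and> brw_pos x \<omega> [i] \<in> brw_class rho p z} \<noteq> 1} > 0)"

text \<open>n-step transition probabilities of the random walk P, and recurrence
  (every state x has infinite Green function sum_n p^(n)(x,x)).\<close>
fun n_step :: "('x \<Rightarrow> 'x pmf) \<Rightarrow> nat \<Rightarrow> 'x \<Rightarrow> 'x pmf" where
  "n_step p 0 x = return_pmf x"
| "n_step p (Suc n) x = bind_pmf (n_step p n x) p"

definition recurrent_rw :: "('x \<Rightarrow> 'x pmf) \<Rightarrow> bool" where
  "recurrent_rw p \<longleftrightarrow> (\<forall>x. (\<Sum>n. ennreal (pmf (n_step p n x) x)) = \<infinity>)"

end

theory Submission
  imports Defs
begin

text \<open>As the offspring law does not depend on the site, the genealogical tree is independent of the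
  displacements.  Condition on an infinite tree: it contains alive particles of every generation, and the
  positions along the ancestral line of a fixed label form a random walk with transition matrix P.
  By irreducibility and recurrence, the probability that such a line avoids y between generations n and
  n + k tends to 0 as k tends to infinity, whence y is visited in infinitely many generations almost
  surely.  So local extinction at y and total extinction differ by a null event, and the probability of
  total extinction is that of the Galton-Watson tree, whatever the starting site.\<close>

lemma nn_integral_PiM_indep_coordinate:
  fixes M :: "'i \<Rightarrow> 'a measure"
  assumes M: "\<And>i. prob_space (M i)"
    and F: "F \<in> borel_measurable (PiM UNIV M)"
    and h: "h \<in> borel_measurable (M c)"
    and inv: "\<And>\<omega> x. F (fun_upd \<omega> c x) = F \<omega>"
  shows "(\<integral>\<^sup>+\<omega>. F \<omega> * h (\<omega> c) \<partial>PiM UNIV M) = (\<integral>\<^sup>+\<omega>. F \<omega> \<partial>PiM UNIV M) * (\<integral>\<^sup>+x. h x \<partial>M c)"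
proof -
  define R where "R = PiM (UNIV - {c}) M"
  interpret Mc: prob_space "M c" by (rule M)
  interpret R: prob_space R unfolding R_def by (intro prob_space_PiM M)
  have ins: "insert c (UNIV - {c}) = UNIV" by auto
  have split: "PiM UNIV M = distr (M c \<Otimes>\<^sub>M R) (PiM UNIV M) (\<lambda>(x, X). fun_upd X c x)"
    using distr_pair_PiM_eq_PiM[of "UNIV - {c}" M c] M unfolding R_def ins by simp
  have upd: "(\<lambda>(x, X). fun_upd X c x) \<in> M c \<Otimes>\<^sub>M R \<rightarrow>\<^sub>M PiM UNIV M"
    unfolding R_def using measurable_fun_upd[of UNIV "UNIV - {c}" c "snd" "M c \<Otimes>\<^sub>M PiM (UNIV - {c}) M" M fst]
    by (auto simp: split_beta')
  have *: "(\<integral>\<^sup>+\<omega>. F \<omega> * k (\<omega> c) \<partial>PiM UNIV M) = (\<integral>\<^sup>+X. F X \<partial>R) * (\<integral>\<^sup>+x. k x \<partial>M c)"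
    if k[measurable]: "k \<in> borel_measurable (M c)" for k
  proof -
    have F'[measurable]: "(\<lambda>z. F (snd z)) \<in> borel_measurable (M c \<Otimes>\<^sub>M R)"
      using measurable_compose[OF upd F] by (simp add: split_beta' inv)
    have Fk: "(\<lambda>\<omega>. F \<omega> * k (\<omega> c)) \<in> borel_measurable (PiM UNIV M)"
      using F by measurable
    obtain x0 where x0: "x0 \<in> space (M c)" using Mc.not_empty by auto
    have FR[measurable]: "F \<in> borel_measurable R"
      using measurable_Pair2[OF F' x0] by simp
    have "(\<integral>\<^sup>+\<omega>. F \<omega> * k (\<omega> c) \<partial>PiM UNIV M) = (\<integral>\<^sup>+z. F (snd z) * k (fst z) \<partial>(M c \<Otimes>\<^sub>M R))"
      by (subst split, subst nn_integral_distr[OF upd]) (use Fk in \<open>simp_all add: split_beta' inv\<close>)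
    also have "\<dots> = (\<integral>\<^sup>+x. \<integral>\<^sup>+X. F X * k x \<partial>R \<partial>M c)"
      by (subst R.nn_integral_fst[symmetric]) simp_all
    also have "\<dots> = (\<integral>\<^sup>+x. (\<integral>\<^sup>+X. F X \<partial>R) * k x \<partial>M c)"
      by (simp add: nn_integral_multc)
    finally show ?thesis by (simp add: nn_integral_cmult)
  qed
  have "(\<integral>\<^sup>+\<omega>. F \<omega> \<partial>PiM UNIV M) = (\<integral>\<^sup>+X. F X \<partial>R)"
    using *[of "\<lambda>_. 1"] by (simp add: Mc.emeasure_space_1)
  then show ?thesis using *[OF h] by simp
qed

lemma nn_integral_PiM_prod:
  fixes M :: "'i \<Rightarrow> 'a measure"
  assumes M: "\<And>i. prob_space (M i)" and "finite J"
    and h: "\<And>i. i \<in> J \<Longrightarrow> h i \<in> borel_measurable (M i)"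
  shows "(\<integral>\<^sup>+\<omega>. (\<Prod>i\<in>J. h i (\<omega> i)) \<partial>PiM UNIV M) = (\<Prod>i\<in>J. \<integral>\<^sup>+x. h i x \<partial>M i)"
  using assms(2,3)
proof (induction J rule: finite_induct)
  case empty
  interpret prob_space "PiM UNIV M" by (intro prob_space_PiM M)
  show ?case by (simp add: emeasure_space_1)
next
  case (insert c J)
  have [measurable]: "h i \<in> borel_measurable (M i)" if "i \<in> J" for i using insert.prems that by auto
  have "(\<integral>\<^sup>+\<omega>. (\<Prod>i\<in>insert c J. h i (\<omega> i)) \<partial>PiM UNIV M)
      = (\<integral>\<^sup>+\<omega>. (\<Prod>i\<in>J. h i (\<omega> i)) * h c (\<omega> c) \<partial>PiM UNIV M)"
    using insert.hyps by (simp add: mult.commute)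
  also have "\<dots> = (\<integral>\<^sup>+\<omega>. (\<Prod>i\<in>J. h i (\<omega> i)) \<partial>PiM UNIV M) * (\<integral>\<^sup>+x. h c x \<partial>M c)"
  proof (rule nn_integral_PiM_indep_coordinate[OF M])
    show "(\<lambda>\<omega>. \<Prod>i\<in>J. h i (\<omega> i)) \<in> borel_measurable (PiM UNIV M)" by measurable
    show "(\<Prod>i\<in>J. h i (fun_upd \<omega> c x i)) = (\<Prod>i\<in>J. h i (\<omega> i))" for \<omega> x
      using insert.hyps by (intro prod.cong) auto
  qed (use insert.prems in auto)
  finally show ?case using insert by (simp add: mult.commute)
qed

lemma space_PiM_pmf [simp]: "space (PiM UNIV (\<lambda>i. measure_pmf (r i))) = UNIV"
  by (simp add: space_PiM)

lemma measurable_zip_PiM_pmf: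
  fixes r :: "'i \<Rightarrow> 'a::countable pmf" and s :: "'i \<Rightarrow> 'b::countable pmf"
  shows "(\<lambda>(b, a) i. (a i, b i)) \<in>
    PiM UNIV (\<lambda>i. measure_pmf (s i)) \<Otimes>\<^sub>M PiM UNIV (\<lambda>i. measure_pmf (r i))
      \<rightarrow>\<^sub>M PiM UNIV (\<lambda>i. measure_pmf (pair_pmf (r i) (s i)))"
    (is "_ \<in> ?B \<Otimes>\<^sub>M ?A \<rightarrow>\<^sub>M _")
  unfolding split_beta'
proof (rule measurable_PiM_single')
  fix i
  have "(\<lambda>z. (snd z i, fst z i)) \<in> ?B \<Otimes>\<^sub>M ?A \<rightarrow>\<^sub>M measure_pmf (r i) \<Otimes>\<^sub>M measure_pmf (s i)"
    by measurable
  moreover have "sets (measure_pmf (r i) \<Otimes>\<^sub>M measure_pmf (s i)) = UNIV"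
    using sets_pair_countable[of "UNIV :: 'a set" "UNIV :: 'b set"]
    by (subst sets_pair_measure_cong[of _ "count_space UNIV" _ "count_space UNIV"]) auto
  ultimately show "(\<lambda>z. (snd z i, fst z i)) \<in> ?B \<Otimes>\<^sub>M ?A \<rightarrow>\<^sub>M measure_pmf (pair_pmf (r i) (s i))"
    by (simp cong: measurable_cong_sets)
qed (auto simp: space_PiM)

lemma PiM_pair_pmf:
  fixes r :: "'i \<Rightarrow> 'a::countable pmf" and s :: "'i \<Rightarrow> 'b::countable pmf"
  shows "PiM UNIV (\<lambda>i. measure_pmf (pair_pmf (r i) (s i))) =
    distr (PiM UNIV (\<lambda>i. measure_pmf (s i)) \<Otimes>\<^sub>M PiM UNIV (\<lambda>i. measure_pmf (r i)))
      (PiM UNIV (\<lambda>i. measure_pmf (pair_pmf (r i) (s i)))) (\<lambda>(b, a) i. (a i, b i))"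
    (is "?P = distr (?B \<Otimes>\<^sub>M ?A) ?P ?Z")
proof (rule measure_eqI_PiM_infinite[OF refl])
  interpret A: prob_space ?A by (intro prob_space_PiM prob_space_measure_pmf)
  interpret B: prob_space ?B by (intro prob_space_PiM prob_space_measure_pmf)
  interpret P: prob_space ?P by (intro prob_space_PiM prob_space_measure_pmf)
  show "finite_measure ?P" by unfold_locales
  note Z = measurable_zip_PiM_pmf[of s r]
  fix C and J :: "'i set"
  assume J: "finite J"
  let ?E = "prod_emb UNIV (\<lambda>i. measure_pmf (pair_pmf (r i) (s i))) J (Pi\<^sub>E J C)"
  have E: "?E \<in> sets ?P" using J by (intro sets_PiM_I) auto
  have Eiff: "\<omega> \<in> ?E \<longleftrightarrow> (\<forall>i\<in>J. \<omega> i \<in> C i)" for \<omega>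
    by (auto simp: prod_emb_def PiE_iff)
  have ind: "indicator ?E (?Z (b, a)) = (\<Prod>i\<in>J. indicator {n. (n, b i) \<in> C i} (a i) :: ennreal)" for a b
    using J by (auto simp: indicator_def Eiff prod_zero_iff)
  have "emeasure (distr (?B \<Otimes>\<^sub>M ?A) ?P ?Z) ?E = (\<integral>\<^sup>+\<omega>. indicator ?E \<omega> \<partial>distr (?B \<Otimes>\<^sub>M ?A) ?P ?Z)"
    using E by simp
  also have "\<dots> = (\<integral>\<^sup>+z. indicator ?E (?Z z) \<partial>(?B \<Otimes>\<^sub>M ?A))"
    using E by (intro nn_integral_distr Z) auto
  also have "\<dots> = (\<integral>\<^sup>+b. \<integral>\<^sup>+a. indicator ?E (?Z (b, a)) \<partial>?A \<partial>?B)"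
    by (intro A.nn_integral_fst[symmetric] measurable_compose[OF Z] borel_measurable_indicator E)
  also have "\<dots> = (\<integral>\<^sup>+b. (\<Prod>i\<in>J. emeasure (measure_pmf (r i)) {n. (n, b i) \<in> C i}) \<partial>?B)"
    unfolding ind by (subst nn_integral_PiM_prod[OF prob_space_measure_pmf J]) auto
  also have "\<dots> = (\<Prod>i\<in>J. \<integral>\<^sup>+z. emeasure (measure_pmf (r i)) {n. (n, z) \<in> C i} \<partial>measure_pmf (s i))"
    by (subst nn_integral_PiM_prod[OF prob_space_measure_pmf J,
        where h="\<lambda>i z. emeasure (measure_pmf (r i)) {n. (n, z) \<in> C i}"]) auto
  also have "\<dots> = (\<Prod>i\<in>J. emeasure (measure_pmf (pair_pmf (r i) (s i))) (C i))"
  proof (rule prod.cong[OF refl])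
    fix i
    have "emeasure (measure_pmf (pair_pmf (r i) (s i))) (C i)
        = (\<integral>\<^sup>+z. indicator (C i) z \<partial>measure_pmf (pair_pmf (r i) (s i)))" by simp
    also have "\<dots> = (\<integral>\<^sup>+z. indicator (C i) (snd z, fst z) \<partial>measure_pmf (pair_pmf (s i) (r i)))"
      by (subst pair_commute_pmf) (simp add: split_beta')
    also have "\<dots> = (\<integral>\<^sup>+z. \<integral>\<^sup>+n. indicator (C i) (n, z) \<partial>measure_pmf (r i) \<partial>measure_pmf (s i))"
      by (subst nn_integral_pair_pmf') simp
    also have "\<dots> = (\<integral>\<^sup>+z. \<integral>\<^sup>+n. indicator {n. (n, z) \<in> C i} n \<partial>measure_pmf (r i) \<partial>measure_pmf (s i))"
      by (simp add: indicator_def)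
    finally show "(\<integral>\<^sup>+z. emeasure (measure_pmf (r i)) {n. (n, z) \<in> C i} \<partial>measure_pmf (s i))
        = emeasure (measure_pmf (pair_pmf (r i) (s i))) (C i)" by simp
  qed
  also have "\<dots> = emeasure ?P ?E"
    using J by (intro emeasure_PiM_emb[symmetric] prob_space_measure_pmf) auto
  finally show "emeasure ?P ?E = emeasure (distr (?B \<Otimes>\<^sub>M ?A) ?P ?Z) ?E" by simp
qed simp

fun walk_pos :: "'x \<Rightarrow> (nat list \<times> 'x \<Rightarrow> 'x) \<Rightarrow> nat list \<Rightarrow> 'x" where
  "walk_pos w b [] = w"
| "walk_pos w b (i # u) = b (i # u, walk_pos w b u)"

fun tree_alive :: "(nat list \<Rightarrow> nat) \<Rightarrow> nat list \<Rightarrow> bool" where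
  "tree_alive t [] = True"
| "tree_alive t (i # u) = (tree_alive t u \<and> i < t u)"

definition disp_space :: "('x \<Rightarrow> 'x pmf) \<Rightarrow> (nat list \<times> 'x \<Rightarrow> 'x) measure" where
  "disp_space p = PiM UNIV (\<lambda>i. measure_pmf (p (snd i)))"

definition tree_space :: "nat pmf \<Rightarrow> (nat list \<Rightarrow> nat) measure" where
  "tree_space rho = PiM UNIV (\<lambda>_. measure_pmf rho)"

definition brw_tree :: "'x \<Rightarrow> 'x brw_omega \<Rightarrow> nat list \<Rightarrow> nat" where
  "brw_tree w \<omega> u = fst (\<omega> (u, brw_pos w \<omega> u))"

lemma brw_pos_eq_walk_pos: "brw_pos w \<omega> u = walk_pos w (snd \<circ> \<omega>) u"
  by (induction u) auto

lemma brw_alive_eq_tree_alive: "brw_alive w \<omega> u = tree_alive (brw_tree w \<omega>) u"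
  by (induction u) (auto simp: brw_tree_def)

lemma space_disp_space [simp]: "space (disp_space p) = UNIV"
  by (simp add: disp_space_def)

lemma space_tree_space [simp]: "space (tree_space rho) = UNIV"
  by (simp add: tree_space_def)

lemma prob_space_disp_space: "prob_space (disp_space p)"
  unfolding disp_space_def by (intro prob_space_PiM prob_space_measure_pmf)

lemma prob_space_tree_space: "prob_space (tree_space rho)"
  unfolding tree_space_def by (intro prob_space_PiM prob_space_measure_pmf)

lemma measurable_disp_coordinate [measurable]:
  "(\<lambda>b. b i) \<in> disp_space p \<rightarrow>\<^sub>M count_space UNIV"
proof -
  have "(\<lambda>b. b i) \<in> disp_space p \<rightarrow>\<^sub>M measure_pmf (p (snd i))"
    unfolding disp_space_def by measurable
  then show ?thesis by simp
qed

lemma measurable_walk_pos [measurable]: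
  fixes w :: "'x::countable"
  shows "(\<lambda>b. walk_pos w b u) \<in> disp_space p \<rightarrow>\<^sub>M count_space UNIV"
proof (induction u)
  case (Cons i u)
  show ?case unfolding walk_pos.simps
    by (rule measurable_compose_countable[OF _ Cons, where f="\<lambda>x b. b (i # u, x)"]) measurable
qed simp

lemma measurable_tree_alive [measurable]: "Measurable.pred (tree_space rho) (\<lambda>t. tree_alive t u)"
proof (induction u)
  case (Cons i u)
  have "(\<lambda>t. t u) \<in> tree_space rho \<rightarrow>\<^sub>M measure_pmf rho"
    unfolding tree_space_def by measurable
  then have "(\<lambda>t. t u) \<in> tree_space rho \<rightarrow>\<^sub>M count_space UNIV" by simp
  from Cons this show ?case by simp
qed simp

text \<open>Since the offspring law does not depend on the site, reading the offspring numbers along the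
  positions is, for a fixed displacement field, an injective reindexing of an i.i.d. family.\<close>

lemma emeasure_brw_space_tree_disp:
  fixes p :: "'x::countable \<Rightarrow> 'x pmf"
  assumes S: "S \<in> sets (disp_space p \<Otimes>\<^sub>M tree_space rho)"
  shows "{\<omega>. (snd \<circ> \<omega>, brw_tree w \<omega>) \<in> S} \<in> sets (brw_space (\<lambda>_. rho) p)"
    and "emeasure (brw_space (\<lambda>_. rho) p) {\<omega>. (snd \<circ> \<omega>, brw_tree w \<omega>) \<in> S}
      = emeasure (disp_space p \<Otimes>\<^sub>M tree_space rho) S"
proof -
  let ?A = "PiM UNIV (\<lambda>i :: nat list \<times> 'x. measure_pmf rho)"
  let ?Z = "\<lambda>(b, a) i. (a i, b i)"
  let ?W = "brw_space (\<lambda>_. rho) p"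
  let ?Th = "\<lambda>\<omega>. (snd \<circ> \<omega>, brw_tree w \<omega>)"
  let ?R = "\<lambda>b a. (\<lambda>u. a (u, walk_pos w b u))"
  interpret A: prob_space ?A by (intro prob_space_PiM prob_space_measure_pmf)
  interpret T: prob_space "tree_space rho" by (rule prob_space_tree_space)
  have W: "?W = PiM UNIV (\<lambda>i. measure_pmf (pair_pmf rho (p (snd i))))"
    by (simp add: brw_space_def split_beta')
  have [simp]: "space ?W = UNIV" by (simp add: W)
  have WZ: "?W = distr (disp_space p \<Otimes>\<^sub>M ?A) ?W ?Z"
    unfolding W disp_space_def by (rule PiM_pair_pmf)
  have coord[measurable]: "(\<lambda>\<omega>. \<omega> i) \<in> ?W \<rightarrow>\<^sub>M count_space UNIV" for i
  proof -
    have "(\<lambda>\<omega>. \<omega> i) \<in> ?W \<rightarrow>\<^sub>M measure_pmf (pair_pmf rho (p (snd i)))"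
      unfolding W by measurable
    then show ?thesis by simp
  qed
  have disp: "(\<lambda>\<omega>. snd \<circ> \<omega>) \<in> ?W \<rightarrow>\<^sub>M disp_space p"
    unfolding disp_space_def by (rule measurable_PiM_single') (auto simp: space_PiM)
  have pos: "(\<lambda>\<omega>. brw_pos w \<omega> u) \<in> ?W \<rightarrow>\<^sub>M count_space UNIV" for u
    unfolding brw_pos_eq_walk_pos by (rule measurable_compose[OF disp measurable_walk_pos])
  have tree: "(\<lambda>\<omega>. brw_tree w \<omega>) \<in> ?W \<rightarrow>\<^sub>M tree_space rho"
    unfolding tree_space_def
  proof (rule measurable_PiM_single')
    fix u
    have "(\<lambda>\<omega>. brw_tree w \<omega> u) \<in> ?W \<rightarrow>\<^sub>M count_space UNIV"
      unfolding brw_tree_def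
      by (rule measurable_compose_countable[OF _ pos, where f="\<lambda>x \<omega>. fst (\<omega> (u, x))"]) measurable
    then show "(\<lambda>\<omega>. brw_tree w \<omega> u) \<in> ?W \<rightarrow>\<^sub>M measure_pmf rho" by simp
  qed (auto simp: space_PiM)
  have Th: "?Th \<in> ?W \<rightarrow>\<^sub>M disp_space p \<Otimes>\<^sub>M tree_space rho"
    using disp tree by measurable
  show ev: "{\<omega>. ?Th \<omega> \<in> S} \<in> sets ?W"
    using measurable_sets[OF Th S] by (simp add: vimage_def)
  have Z: "?Z \<in> disp_space p \<Otimes>\<^sub>M ?A \<rightarrow>\<^sub>M ?W"
    unfolding W disp_space_def by (rule measurable_zip_PiM_pmf)
  have reindex: "distr ?A (tree_space rho) (?R b) = tree_space rho" for b
    using distr_PiM_reindex[of UNIV "\<lambda>_ :: nat list \<times> 'x. measure_pmf rho" "\<lambda>u. (u, walk_pos w b u)" UNIV]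
    unfolding tree_space_def by (simp add: prob_space_measure_pmf inj_on_def restrict_def)
  have R: "?R b \<in> ?A \<rightarrow>\<^sub>M tree_space rho" for b
    unfolding tree_space_def
    by (rule measurable_PiM_single') (rule measurable_component_singleton, auto simp: space_PiM)
  have ThZ: "?Th (?Z (b, a)) = (b, ?R b a)" for a b
    by (auto simp: brw_tree_def brw_pos_eq_walk_pos comp_def fun_eq_iff)
  have "emeasure ?W {\<omega>. ?Th \<omega> \<in> S}
      = emeasure (disp_space p \<Otimes>\<^sub>M ?A) (?Z -` {\<omega>. ?Th \<omega> \<in> S} \<inter> space (disp_space p \<Otimes>\<^sub>M ?A))"
    by (subst WZ, rule emeasure_distr[OF Z ev])
  also have "?Z -` {\<omega>. ?Th \<omega> \<in> S} \<inter> space (disp_space p \<Otimes>\<^sub>M ?A) = {(b, a). (b, ?R b a) \<in> S}"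
    using ThZ by (auto simp: space_pair_measure)
  also have "emeasure (disp_space p \<Otimes>\<^sub>M ?A) {(b, a). (b, ?R b a) \<in> S}
      = (\<integral>\<^sup>+b. emeasure ?A {a. (b, ?R b a) \<in> S} \<partial>disp_space p)"
  proof (subst A.emeasure_pair_measure_alt)
    have "?Z -` {\<omega>. ?Th \<omega> \<in> S} \<inter> space (disp_space p \<Otimes>\<^sub>M ?A) = {(b, a). (b, ?R b a) \<in> S}"
      using ThZ by (auto simp: space_pair_measure)
    then show "{(b, a). (b, ?R b a) \<in> S} \<in> sets (disp_space p \<Otimes>\<^sub>M ?A)"
      using measurable_sets[OF Z ev] by simp
  qed (simp add: vimage_def)
  also have "\<dots> = (\<integral>\<^sup>+b. emeasure (tree_space rho) (Pair b -` S) \<partial>disp_space p)"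
  proof (rule nn_integral_cong)
    fix b
    have "emeasure (tree_space rho) (Pair b -` S) = emeasure (distr ?A (tree_space rho) (?R b)) (Pair b -` S)"
      by (simp add: reindex)
    also have "\<dots> = emeasure ?A {a. (b, ?R b a) \<in> S}"
      by (subst emeasure_distr[OF R sets_Pair1[OF S]]) (simp add: vimage_def)
    finally show "emeasure ?A {a. (b, ?R b a) \<in> S} = emeasure (tree_space rho) (Pair b -` S)" by simp
  qed
  also have "\<dots> = emeasure (disp_space p \<Otimes>\<^sub>M tree_space rho) S"
    using S by (rule T.emeasure_pair_measure_alt[symmetric])
  finally show "emeasure ?W {\<omega>. ?Th \<omega> \<in> S} = emeasure (disp_space p \<Otimes>\<^sub>M tree_space rho) S" .
qed


lemma walk_pos_fun_upd:
  "length u < length v \<Longrightarrow> walk_pos w (fun_upd b (v, x) z) u = walk_pos w b u"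
  by (induction u) auto

lemma nn_integral_walk_step:
  fixes p :: "'x::countable \<Rightarrow> 'x pmf"
  assumes F[measurable]: "F \<in> borel_measurable (disp_space p)"
    and inv: "\<And>b x z. F (fun_upd b (i # u, x) z) = F b"
  shows "(\<integral>\<^sup>+b. F b * f (walk_pos w b (i # u)) \<partial>disp_space p)
    = (\<integral>\<^sup>+b. F b * (\<integral>\<^sup>+z. f z \<partial>p (walk_pos w b u)) \<partial>disp_space p)"
proof -
  let ?I = "\<lambda>x b. indicator {x} (walk_pos w b u) :: ennreal"
  have pick: "h a = (\<integral>\<^sup>+x. indicator {x} a * h x \<partial>count_space UNIV)" for a :: 'x and h :: "'x \<Rightarrow> ennreal"
    using nn_integral_indicator_singleton[of a "count_space UNIV" h]
    by (simp add: indicator_def eq_commute[of a] mult.commute)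
  have I[measurable]: "?I x \<in> borel_measurable (disp_space p)" for x
    by (rule measurable_compose[OF measurable_walk_pos]) simp
  have step: "(\<integral>\<^sup>+b. (F b * ?I x b) * f (b (i # u, x)) \<partial>disp_space p)
      = (\<integral>\<^sup>+b. F b * ?I x b \<partial>disp_space p) * (\<integral>\<^sup>+z. f z \<partial>p x)" for x
  proof -
    have FI: "(\<lambda>b. F b * ?I x b) \<in> borel_measurable (disp_space p)" by measurable
    have "F (fun_upd b (i # u, x) z) * ?I x (fun_upd b (i # u, x) z) = F b * ?I x b" for b z
      by (simp add: inv walk_pos_fun_upd)
    with FI nn_integral_PiM_indep_coordinate[of "\<lambda>j. measure_pmf (p (snd j))" "\<lambda>b. F b * ?I x b" f "(i # u, x)"]
    show ?thesis
      by (simp add: disp_space_def prob_space_measure_pmf)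
  qed
  have "(\<integral>\<^sup>+b. F b * f (walk_pos w b (i # u)) \<partial>disp_space p)
      = (\<integral>\<^sup>+b. \<integral>\<^sup>+x. (F b * ?I x b) * f (b (i # u, x)) \<partial>count_space UNIV \<partial>disp_space p)"
  proof (rule nn_integral_cong)
    fix b
    show "F b * f (walk_pos w b (i # u)) = (\<integral>\<^sup>+x. (F b * ?I x b) * f (b (i # u, x)) \<partial>count_space UNIV)"
      using pick[where h="\<lambda>x. f (b (i # u, x))" and a="walk_pos w b u"]
      by (simp add: mult.assoc nn_integral_cmult)
  qed
  also have "\<dots> = (\<integral>\<^sup>+x. \<integral>\<^sup>+b. (F b * ?I x b) * f (b (i # u, x)) \<partial>disp_space p \<partial>count_space UNIV)"
    by (intro nn_integral_count_space_nn_integral) auto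
  also have "\<dots> = (\<integral>\<^sup>+x. \<integral>\<^sup>+b. (F b * ?I x b) * (\<integral>\<^sup>+z. f z \<partial>p x) \<partial>disp_space p \<partial>count_space UNIV)"
    unfolding step by (intro nn_integral_cong nn_integral_multc[symmetric]) auto
  also have "\<dots> = (\<integral>\<^sup>+b. \<integral>\<^sup>+x. (F b * ?I x b) * (\<integral>\<^sup>+z. f z \<partial>p x) \<partial>count_space UNIV \<partial>disp_space p)"
    by (intro nn_integral_count_space_nn_integral[symmetric]) auto
  also have "\<dots> = (\<integral>\<^sup>+b. F b * (\<integral>\<^sup>+z. f z \<partial>p (walk_pos w b u)) \<partial>disp_space p)"
  proof (rule nn_integral_cong)
    fix b
    show "(\<integral>\<^sup>+x. (F b * ?I x b) * (\<integral>\<^sup>+z. f z \<partial>p x) \<partial>count_space UNIV)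
        = F b * (\<integral>\<^sup>+z. f z \<partial>p (walk_pos w b u))"
      using pick[where h="\<lambda>x. \<integral>\<^sup>+z. f z \<partial>p x" and a="walk_pos w b u"]
      by (simp add: mult.assoc nn_integral_cmult)
  qed
  finally show ?thesis .
qed

definition taboo_op :: "('x \<Rightarrow> 'x pmf) \<Rightarrow> 'x \<Rightarrow> ('x \<Rightarrow> ennreal) \<Rightarrow> 'x \<Rightarrow> ennreal" where
  "taboo_op p y f x = (\<integral>\<^sup>+z. indicator (- {y}) z * f z \<partial>p x)"

definition avoid_prob :: "('x \<Rightarrow> 'x pmf) \<Rightarrow> 'x \<Rightarrow> nat \<Rightarrow> 'x \<Rightarrow> ennreal" where
  "avoid_prob p y k x = indicator (- {y}) x * (taboo_op p y ^^ k) (\<lambda>_. 1) x"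

lemma nn_integral_walk_pos:
  fixes p :: "'x::countable \<Rightarrow> 'x pmf"
  shows "(\<integral>\<^sup>+b. f (walk_pos w b u) \<partial>disp_space p) = (\<integral>\<^sup>+x. f x \<partial>n_step p (length u) w)"
proof (induction u arbitrary: f)
  case Nil
  then show ?case using prob_space.emeasure_space_1[OF prob_space_disp_space, of p] by simp
next
  case (Cons i u)
  show ?case
    using nn_integral_walk_step[where F="\<lambda>_. 1" and p=p and i=i and u=u and f=f and w=w] Cons[of "\<lambda>x. \<integral>\<^sup>+z. f z \<partial>p x"] by simp
qed

lemma nn_integral_walk_avoid:
  fixes p :: "'x::countable \<Rightarrow> 'x pmf"
  shows "(\<integral>\<^sup>+b. (\<Prod>j\<le>length v. indicator (- {y}) (walk_pos w b (drop j (v @ u)))) * f (walk_pos w b (v @ u)) \<partial>disp_space p)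
    = (\<integral>\<^sup>+x. indicator (- {y}) x * (taboo_op p y ^^ length v) f x \<partial>n_step p (length u) w)"
proof (induction v arbitrary: f)
  case Nil
  show ?case using nn_integral_walk_pos[where f="\<lambda>x. indicator (- {y}) x * f x" and w=w and u=u and p=p] by simp
next
  case (Cons i v)
  let ?F = "\<lambda>b. (\<Prod>j\<le>length v. indicator (- {y}) (walk_pos w b (drop j (v @ u)))) :: ennreal"
  have [measurable]: "(\<lambda>b. indicator (- {y}) (walk_pos w b u') :: ennreal) \<in> borel_measurable (disp_space p)" for u'
    by (rule measurable_compose[OF measurable_walk_pos]) simp
  have "(\<integral>\<^sup>+b. (\<Prod>j\<le>length (i # v). indicator (- {y}) (walk_pos w b (drop j ((i # v) @ u)))) * f (walk_pos w b ((i # v) @ u)) \<partial>disp_space p)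
     = (\<integral>\<^sup>+b. ?F b * (indicator (- {y}) (walk_pos w b (i # v @ u)) * f (walk_pos w b (i # v @ u))) \<partial>disp_space p)"
    by (simp add: prod.atMost_Suc_shift ac_simps del: prod.atMost_Suc walk_pos.simps)
  also have "\<dots> = (\<integral>\<^sup>+b. ?F b * taboo_op p y f (walk_pos w b (v @ u)) \<partial>disp_space p)"
    unfolding taboo_op_def
  proof (rule nn_integral_walk_step[where f="\<lambda>z. indicator (- {y}) z * f z"])
    show "?F \<in> borel_measurable (disp_space p)" by measurable
    show "?F (fun_upd b (i # v @ u, x) z) = ?F b" for b x z
      by (intro prod.cong refl arg_cong[where f="indicator (- {y})"] walk_pos_fun_upd) auto
  qed
  also have "\<dots> = (\<integral>\<^sup>+x. indicator (- {y}) x * (taboo_op p y ^^ length v) (taboo_op p y f) x \<partial>n_step p (length u) w)"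
    by (rule Cons)
  finally show ?case by (simp add: funpow_swap1)
qed

lemma avoid_prob_Suc: "avoid_prob p y (Suc k) x = indicator (- {y}) x * (\<integral>\<^sup>+z. avoid_prob p y k z \<partial>p x)"
  by (simp add: avoid_prob_def taboo_op_def)

lemma avoid_prob_le_1: "avoid_prob p y k x \<le> 1"
proof (induction k arbitrary: x)
  case 0 show ?case by (simp add: avoid_prob_def indicator_def)
next
  case (Suc k)
  have "(\<integral>\<^sup>+z. avoid_prob p y k z \<partial>p x) \<le> (\<integral>\<^sup>+z. 1 \<partial>p x)" by (intro nn_integral_mono Suc)
  then show ?case by (simp add: avoid_prob_Suc indicator_def)
qed

lemma avoid_prob_Suc_le: "avoid_prob p y (Suc k) x \<le> avoid_prob p y k x"
proof (induction k arbitrary: x)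
  case 0
  show ?case using avoid_prob_le_1[of p y "Suc 0" x]
    by (auto simp: avoid_prob_def indicator_def)
next
  case (Suc k)
  show ?case
    by (subst (1 2) avoid_prob_Suc) (intro mult_left_mono nn_integral_mono Suc zero_le)
qed

lemma decseq_avoid_prob: "decseq (avoid_prob p y)"
  by (rule decseq_SucI) (simp add: le_fun_def avoid_prob_Suc_le)

lemma nn_integral_INF_avoid_prob:
  fixes q :: "'x pmf"
  shows "(\<integral>\<^sup>+x. (INF k. avoid_prob p y k x) \<partial>q) = (INF k. \<integral>\<^sup>+x. avoid_prob p y k x \<partial>q)"
proof (rule nn_integral_monotone_convergence_INF_decseq[OF decseq_avoid_prob])
  fix k
  have "(\<integral>\<^sup>+x. avoid_prob p y k x \<partial>q) \<le> (\<integral>\<^sup>+x. 1 \<partial>q)" by (intro nn_integral_mono avoid_prob_le_1)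
  then show "(\<integral>\<^sup>+x. avoid_prob p y k x \<partial>q) < \<infinity>" by (simp add: le_less_trans[OF _ ennreal_one_less_top])
qed simp

text \<open>With g the probability of never visiting y and e the probability of never returning to y, one has
  P g = g + e 1_y; iterating gives P^N g (y) = g(y) + e (sum over n < N of p^(n)(y,y)), which forces e = 0.
  Then g is harmonic and vanishes at y, hence everywhere.\<close>

lemma INF_avoid_prob_eq_0:
  fixes p :: "'x \<Rightarrow> 'x pmf"
  assumes irr: "\<And>x z. (x, z) \<in> {(x, z). pmf (p x) z > 0}\<^sup>*"
    and rec: "recurrent_rw p"
  shows "(INF k. avoid_prob p y k x) = 0"
proof -
  define g where "g x = (INF k. avoid_prob p y k x)" for x
  define e where "e = (\<integral>\<^sup>+z. g z \<partial>p y)"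
  have g_le: "g x \<le> 1" for x
    unfolding g_def by (rule INF_lower2[of 0]) (auto intro: avoid_prob_le_1)
  have gy: "g y = 0"
    unfolding g_def by (rule antisym, rule INF_lower2[of 0]) (auto simp: avoid_prob_def)
  have g_eq: "g x = (\<integral>\<^sup>+z. g z \<partial>p x)" if "x \<noteq> y" for x
  proof -
    have "g x = (INF k. avoid_prob p y (Suc k) x)"
      unfolding g_def
    proof (rule antisym)
      show "(INF k. avoid_prob p y k x) \<le> (INF k. avoid_prob p y (Suc k) x)"
        by (intro INF_greatest INF_lower) auto
      show "(INF k. avoid_prob p y (Suc k) x) \<le> (INF k. avoid_prob p y k x)"
        by (intro INF_mono) (auto intro: avoid_prob_Suc_le)
    qed
    also have "\<dots> = (INF k. \<integral>\<^sup>+z. avoid_prob p y k z \<partial>p x)"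
      using that by (simp add: avoid_prob_Suc)
    finally show ?thesis by (simp add: g_def nn_integral_INF_avoid_prob)
  qed
  have Pg: "(\<integral>\<^sup>+z. g z \<partial>p x) = g x + e * indicator {y} x" for x
    using g_eq[of x] gy by (cases "x = y") (auto simp: e_def)
  have iter: "(\<integral>\<^sup>+z. g z \<partial>n_step p N y) = e * (\<Sum>n<N. ennreal (pmf (n_step p n y) y))" for N
  proof (induction N)
    case 0 show ?case by (simp add: gy)
  next
    case (Suc N)
    have "(\<integral>\<^sup>+z. g z \<partial>n_step p (Suc N) y) = (\<integral>\<^sup>+x. g x + e * indicator {y} x \<partial>n_step p N y)"
      by (simp add: Pg)
    also have "\<dots> = (\<integral>\<^sup>+x. g x \<partial>n_step p N y) + e * emeasure (n_step p N y) {y}"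
      by (simp add: nn_integral_add nn_integral_cmult)
    finally show ?case using Suc by (simp add: emeasure_pmf_single distrib_left)
  qed
  have "e * (\<Sum>n. ennreal (pmf (n_step p n y) y)) \<le> 1"
  proof -
    have "e * (\<Sum>n<N. ennreal (pmf (n_step p n y) y)) \<le> 1" for N
    proof -
      have "(\<integral>\<^sup>+z. g z \<partial>n_step p N y) \<le> (\<integral>\<^sup>+z. 1 \<partial>n_step p N y)" by (intro nn_integral_mono g_le)
      then show ?thesis by (simp add: iter)
    qed
    then show ?thesis
      by (auto simp: suminf_eq_SUP SUP_mult_left_ennreal intro!: SUP_least)
  qed
  moreover have "(\<Sum>n. ennreal (pmf (n_step p n y) y)) = top"
    using rec unfolding recurrent_rw_def infinity_ennreal_def by blast
  ultimately have "e * top \<le> 1" by simp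
  then have e0: "e = 0" by (simp add: ennreal_mult_top top_unique split: if_splits)
  have "g x = 0"
    using irr[of y x]
  proof (induction rule: rtrancl_induct)
    case base show ?case by (rule gy)
  next
    case (step x z)
    have "(\<integral>\<^sup>+z. g z \<partial>p x) = 0" using Pg[of x] step.IH e0 by simp
    then have "AE z in p x. g z = 0" by (simp add: nn_integral_0_iff_AE)
    then show ?case using step.hyps(2) by (auto simp: AE_measure_pmf_iff set_pmf_iff)
  qed
  then show ?thesis by (simp add: g_def)
qed

lemma tree_alive_drop: "tree_alive t u \<Longrightarrow> tree_alive t (drop j u)"
  by (induction u arbitrary: j) (auto split: nat.split simp: drop_Cons)

lemma local_extinction_null_on_infinite_tree:
  fixes p :: "'x::countable \<Rightarrow> 'x pmf"
  assumes irr: "\<And>x z. (x, z) \<in> {(x, z). pmf (p x) z > 0}\<^sup>*"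
    and rec: "recurrent_rw p"
    and inf: "\<And>n. \<exists>u. length u = n \<and> tree_alive t u"
  shows "emeasure (disp_space p)
    {b. \<exists>n. \<forall>u. tree_alive t u \<and> length u \<ge> n \<longrightarrow> walk_pos w b u \<noteq> y} = 0"
proof -
  let ?L = "\<lambda>n. {b. \<forall>u. tree_alive t u \<and> length u \<ge> n \<longrightarrow> walk_pos w b u \<noteq> y}"
  have "?L n \<in> null_sets (disp_space p)" for n
  proof
    have "{b \<in> space (disp_space p). \<forall>u. tree_alive t u \<and> length u \<ge> n \<longrightarrow> walk_pos w b u \<noteq> y} \<in> sets (disp_space p)"
      by measurable
    then show L: "?L n \<in> sets (disp_space p)" by simp
    have "emeasure (disp_space p) (?L n) \<le> (\<integral>\<^sup>+x. avoid_prob p y k x \<partial>n_step p n w)" for k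
    proof -
      obtain s where s: "length s = k + n" "tree_alive t s" using inf by blast
      define v u where "v = take k s" and "u = drop k s"
      have vu: "s = v @ u" "length v = k" "length u = n" using s by (auto simp: v_def u_def)
      have "indicator (?L n) b \<le> (\<Prod>j\<le>length v. indicator (- {y}) (walk_pos w b (drop j (v @ u))) :: ennreal)" for b
      proof (cases "b \<in> ?L n")
        case True
        have "walk_pos w b (drop j (v @ u)) \<noteq> y" if "j \<le> length v" for j
          using True tree_alive_drop[OF s(2), of j] that vu by auto
        then show ?thesis by (simp add: indicator_def)
      qed simp
      then have "(\<integral>\<^sup>+b. indicator (?L n) b \<partial>disp_space p)
        \<le> (\<integral>\<^sup>+b. (\<Prod>j\<le>length v. indicator (- {y}) (walk_pos w b (drop j (v @ u)))) * 1 \<partial>disp_space p)"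
        by (intro nn_integral_mono) simp
      also have "\<dots> = (\<integral>\<^sup>+x. avoid_prob p y k x \<partial>n_step p n w)"
        unfolding avoid_prob_def using nn_integral_walk_avoid[where v=v and y=y and w=w and u=u and f="\<lambda>_. 1" and p=p] vu by simp
      finally show ?thesis using L by simp
    qed
    then have "emeasure (disp_space p) (?L n) \<le> (INF k. \<integral>\<^sup>+x. avoid_prob p y k x \<partial>n_step p n w)"
      by (rule INF_greatest)
    also have "\<dots> = 0"
      by (simp add: nn_integral_INF_avoid_prob[symmetric] INF_avoid_prob_eq_0[OF irr rec])
    finally show "emeasure (disp_space p) (?L n) = 0" by simp
  qed
  then have "(\<Union>n. ?L n) \<in> null_sets (disp_space p)" by blast
  then show ?thesis by (simp add: null_sets_def Collect_ex_eq)
qed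

theorem mainTheorem9:
  fixes rho :: "nat pmf" and p :: "'x::countable \<Rightarrow> 'x pmf"
  assumes "brw_irreducible (\<lambda>_. rho) p"
    and "standing_assumption (\<lambda>_. rho) p"
    and "recurrent_rw p"
    and "\<exists>x. global_survival (\<lambda>_. rho) p x"
  shows "\<forall>w y. local_ext_prob (\<lambda>_. rho) p w y = ext_prob (\<lambda>_. rho) p w
                \<and> ext_prob (\<lambda>_. rho) p w < 1"
proof (intro allI)
  fix w y :: 'x
  let ?D = "disp_space p" and ?T = "tree_space rho"
  let ?W = "brw_space (\<lambda>_. rho) p"
  interpret D: prob_space ?D by (rule prob_space_disp_space)
  interpret T: prob_space ?T by (rule prob_space_tree_space)
  interpret DT: pair_prob_space ?D ?T ..
  have irr: "(x, z) \<in> {(x, z). pmf (p x) z > 0}\<^sup>*" for x z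
  proof -
    have "brw_edges (\<lambda>_. rho) p \<subseteq> {(x, z). pmf (p x) z > 0}"
      by (auto simp: brw_edges_def first_moment_def zero_less_iff_neq_zero ennreal_eq_0_iff not_le)
    then show ?thesis
      using assms(1) rtrancl_mono unfolding brw_irreducible_def by blast
  qed
  define E where "E = {(b :: nat list \<times> 'x \<Rightarrow> 'x, t). \<exists>n. \<forall>u. length u = n \<longrightarrow> \<not> tree_alive t u}"
  define L where "L = {(b, t). \<exists>n. \<forall>u. tree_alive t u \<and> length u \<ge> n \<longrightarrow> walk_pos w b u \<noteq> y}"
  have [simp]: "space (?D \<Otimes>\<^sub>M ?T) = UNIV" by (simp add: space_pair_measure)
  have alive[measurable]: "Measurable.pred (?D \<Otimes>\<^sub>M ?T) (\<lambda>z. tree_alive (snd z) u)" for u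
    by (rule measurable_compose[OF measurable_snd measurable_tree_alive])
  have walk[measurable]: "(\<lambda>z. walk_pos w (fst z) u) \<in> ?D \<Otimes>\<^sub>M ?T \<rightarrow>\<^sub>M count_space UNIV" for u
    by (rule measurable_compose[OF measurable_fst measurable_walk_pos])
  have E: "E \<in> sets (?D \<Otimes>\<^sub>M ?T)"
  proof -
    have "{z \<in> space (?D \<Otimes>\<^sub>M ?T). \<exists>n. \<forall>u. length u = n \<longrightarrow> \<not> tree_alive (snd z) u} \<in> sets (?D \<Otimes>\<^sub>M ?T)"
      by measurable
    then show ?thesis by (simp add: E_def split_beta')
  qed
  have L: "L \<in> sets (?D \<Otimes>\<^sub>M ?T)"
  proof -
    have "{z \<in> space (?D \<Otimes>\<^sub>M ?T). \<exists>n. \<forall>u. tree_alive (snd z) u \<and> length u \<ge> n \<longrightarrow> walk_pos w (fst z) u \<noteq> y}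
        \<in> sets (?D \<Otimes>\<^sub>M ?T)" by measurable
    then show ?thesis by (simp add: L_def split_beta')
  qed
  have "E \<subseteq> L"
  proof -
    have "length u < n" if "\<forall>v. length v = n \<longrightarrow> \<not> tree_alive t v" "tree_alive t u" for t u n
      using that(1)[rule_format, of "drop (length u - n) u"] tree_alive_drop[OF that(2)] by fastforce
    then show ?thesis unfolding E_def L_def using not_le by blast
  qed
  have "emeasure (?D \<Otimes>\<^sub>M ?T) (L - E) = (\<integral>\<^sup>+t. emeasure ?D ((\<lambda>b. (b, t)) -` (L - E)) \<partial>?T)"
    using E L by (intro DT.emeasure_pair_measure_alt2) auto
  also have "\<dots> = (\<integral>\<^sup>+t. 0 \<partial>?T)"
  proof (rule nn_integral_cong)
    fix t
    show "emeasure ?D ((\<lambda>b. (b, t)) -` (L - E)) = 0"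
    proof (cases "\<forall>n. \<exists>u. length u = n \<and> tree_alive t u")
      case True
      then have "(b, t) \<notin> E" for b by (simp add: E_def)
      then have "(\<lambda>b. (b, t)) -` (L - E) = {b. \<exists>n. \<forall>u. tree_alive t u \<and> length u \<ge> n \<longrightarrow> walk_pos w b u \<noteq> y}"
        by (simp add: vimage_def L_def)
      then show ?thesis
        using local_extinction_null_on_infinite_tree[OF irr assms(3), of t w y] True by simp
    next
      case False
      then have "(\<lambda>b. (b, t)) -` (L - E) = {}" by (auto simp: E_def)
      then show ?thesis by (metis emeasure_empty)
    qed
  qed
  finally have null: "emeasure (?D \<Otimes>\<^sub>M ?T) (L - E) = 0" by simp
  have "emeasure (?D \<Otimes>\<^sub>M ?T) L = emeasure (?D \<Otimes>\<^sub>M ?T) (E \<union> (L - E))"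
    using \<open>E \<subseteq> L\<close> by (simp add: Un_absorb1)
  also have "\<dots> = emeasure (?D \<Otimes>\<^sub>M ?T) E"
    using E L null by (subst plus_emeasure[symmetric]) auto
  finally have LE: "emeasure (?D \<Otimes>\<^sub>M ?T) L = emeasure (?D \<Otimes>\<^sub>M ?T) E" .
  have ext: "ext_prob (\<lambda>_. rho) p v = measure (?D \<Otimes>\<^sub>M ?T) E" for v
    using emeasure_brw_space_tree_disp(2)[OF E, of v]
    by (simp add: ext_prob_def measure_def E_def brw_alive_eq_tree_alive)
  have loc: "local_ext_prob (\<lambda>_. rho) p w y = measure (?D \<Otimes>\<^sub>M ?T) L"
    using emeasure_brw_space_tree_disp(2)[OF L, of w]
    by (simp add: local_ext_prob_def measure_def L_def brw_alive_eq_tree_alive brw_pos_eq_walk_pos)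
  obtain x where x: "global_survival (\<lambda>_. rho) p x" using assms(4) by blast
  have "- E \<in> sets (?D \<Otimes>\<^sub>M ?T)" using E sets.compl_sets[OF E] by (simp add: Compl_eq_Diff_UNIV)
  from emeasure_brw_space_tree_disp(2)[OF this, of x]
  have "measure (?D \<Otimes>\<^sub>M ?T) (- E) = measure ?W {\<omega>. \<forall>n. \<exists>u. length u = n \<and> brw_alive x \<omega> u}"
    by (simp add: measure_def E_def brw_alive_eq_tree_alive)
  then have "measure (?D \<Otimes>\<^sub>M ?T) (- E) > 0" using x by (simp add: global_survival_def)
  then have "measure (?D \<Otimes>\<^sub>M ?T) E < 1"
    using DT.prob_compl[OF E] by (simp add: Compl_eq_Diff_UNIV)
  then show "local_ext_prob (\<lambda>_. rho) p w y = ext_prob (\<lambda>_. rho) p w \<and> ext_prob (\<lambda>_. rho) p w < 1"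
    using LE by (simp add: ext loc measure_def)
qed

end
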